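(* Let $\nu>0$ with $\nu\neq 1$, let $\lambda_1,\lambda_2>0$, and let $X\sim\mathrm{CMP}(\lambda_1,\nu)$ and $Y\sim\mathrm{CMP}(\lambda_2,\nu)$ be independent. Then $X+Y\not\sim\mathrm{CMP}(\lambda_1+\lambda_2,\nu)$.
   Context: For $\lambda,\nu>0$, $X\sim\mathrm{CMP}(\lambda,\nu)$ (COM-Poisson distribution) means $P(X=k)=\frac{\lambda^k}{(k!)^\nu}\cdot\frac{1}{Z(\lambda,\nu)}$ for $k=0,1,2,\dots$, where $Z(\lambda,\nu)=\sum_{i=0}^\infty\frac{\lambda^i}{(i!)^\nu}$. *)

theory Defs
  imports "HOL-Probability.Probability" "HOL-Real_Asymp.Real_Asymp"
begin

definition CMP_Z :: "real \<Rightarrow> real \<Rightarrow> real" where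
  "CMP_Z l \<nu> = (\<Sum>i. l ^ i / (fact i) powr \<nu>)"

definition CMP_mass :: "real \<Rightarrow> real \<Rightarrow> nat \<Rightarrow> real" where
  "CMP_mass l \<nu> k = l ^ k / (fact k) powr \<nu> * (1 / CMP_Z l \<nu>)"

text \<open>
  \<open>distributed\<close> over the counting measure says that \<open>X\<close> is measurable and that
  the probability of \<open>X = k\<close> is \<open>CMP_mass l \<nu> k\<close> for every \<open>k\<close>.
\<close>
definition CMP_distributed :: "'a measure \<Rightarrow> ('a \<Rightarrow> nat) \<Rightarrow> real \<Rightarrow> real \<Rightarrow> bool" where
  "CMP_distributed M X l \<nu> \<longleftrightarrow>
     distributed M (count_space UNIV) X (\<lambda>k. ennreal (CMP_mass l \<nu> k))"

text \<open>The series for the normalising constant converges, so \<open>suminf\<close> is its actual sum.\<close>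

lemma CMP_Z_summable:
  assumes "l > 0" "\<nu> > 0"
  shows "summable (\<lambda>i. l ^ i / (fact i :: real) powr \<nu>)"
proof -
  have "(\<lambda>n. l * (1 / (real (Suc n)) powr \<nu>)) \<longlonglongrightarrow> 0"
    using assms by real_asymp
  then have "eventually (\<lambda>n. l * (1 / (real (Suc n)) powr \<nu>) < 1 / 2) sequentially"
    by (rule order_tendstoD) simp
  then obtain N where N: "\<And>n. n \<ge> N \<Longrightarrow> l * (1 / (real (Suc n)) powr \<nu>) < 1 / 2"
    by (auto simp: eventually_sequentially)
  show ?thesis
  proof (rule summable_ratio_test[of "1/2" N])
    fix n assume n: "n \<ge> N"
    let ?a = "l ^ n / (fact n :: real) powr \<nu>"
    have "(fact (Suc n) :: real) powr \<nu> = real (Suc n) powr \<nu> * fact n powr \<nu>"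
      unfolding fact_Suc by (rule powr_mult)
    then have "l ^ Suc n / (fact (Suc n) :: real) powr \<nu> = (l * (1 / (real (Suc n)) powr \<nu>)) * ?a"
      by simp
    also have "\<dots> \<le> 1 / 2 * ?a"
      using N[OF n] assms by (intro mult_right_mono) auto
    finally show "norm (l ^ Suc n / (fact (Suc n) :: real) powr \<nu>) \<le> 1 / 2 * norm ?a"
      using assms by simp
  qed simp
qed

lemma CMP_mass_sums_1:
  assumes "l > 0" "\<nu> > 0"
  shows "CMP_mass l \<nu> sums 1"
proof -
  have pos: "CMP_Z l \<nu> > 0"
    unfolding CMP_Z_def using assms by (intro suminf_pos CMP_Z_summable) auto
  have "(\<lambda>k. l ^ k / (fact k) powr \<nu>) sums CMP_Z l \<nu>"
    unfolding CMP_Z_def by (intro summable_sums CMP_Z_summable assms)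
  from sums_mult2[OF this, of "1 / CMP_Z l \<nu>"] pos show ?thesis
    unfolding CMP_mass_def by simp
qed

lemma CMP_distributed_prob:
  assumes "prob_space M" "l > 0" "\<nu> > 0" "CMP_distributed M X l \<nu>"
  shows "measure M {\<omega> \<in> space M. X \<omega> = k} = CMP_mass l \<nu> k"
proof -
  have "CMP_Z l \<nu> \<ge> 0"
    unfolding CMP_Z_def using assms by (intro suminf_nonneg CMP_Z_summable) auto
  then have nn: "CMP_mass l \<nu> k \<ge> 0"
    using assms by (simp add: CMP_mass_def)
  have "X -` {k} \<inter> space M = {\<omega> \<in> space M. X \<omega> = k}"
    by auto
  with distributed_emeasure[OF assms(4)[unfolded CMP_distributed_def], of "{k}"]
  have "emeasure M {\<omega> \<in> space M. X \<omega> = k} = ennreal (CMP_mass l \<nu> k)"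
    by simp
  with nn show ?thesis
    by (simp add: measure_def)
qed

end

theory Submission
  imports Defs
begin

text \<open>
  The point masses of \<open>X\<close>, \<open>Y\<close> and of the supposed law of \<open>X + Y\<close> at \<open>0\<close> are the reciprocals of the
  normalising constants, so independence and the event \<open>X + Y = 0\<close> force
  \<open>Z(l1 + l2) = Z(l1) * Z(l2)\<close>, and the constants cancel from the convolution identity at every
  other point. At \<open>1\<close> that identity is trivially true, since \<open>0! = 1! = 1\<close> hides the exponent. The
  first point that sees \<open>\<nu>\<close> is \<open>2\<close>: there
  \<open>l1\<^sup>2 / 2 powr \<nu> + l1 * l2 + l2\<^sup>2 / 2 powr \<nu> = (l1 + l2)\<^sup>2 / 2 powr \<nu>\<close>, so that
  comparing the coefficients of the cross term \<open>l1 * l2\<close> gives \<open>2 powr \<nu> = 2\<close>, that is, \<open>\<nu> = 1\<close>.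
\<close>

lemma (in prob_space) prob_add_indep_nat:
  fixes X Y :: "'a \<Rightarrow> nat"
  assumes indep: "indep_var (count_space UNIV) X (count_space UNIV) Y"
  shows "prob {\<omega> \<in> space M. X \<omega> + Y \<omega> = n} =
    (\<Sum>k\<le>n. prob {\<omega> \<in> space M. X \<omega> = k} * prob {\<omega> \<in> space M. Y \<omega> = n - k})"
proof -
  have [measurable]: "X \<in> measurable M (count_space UNIV)" "Y \<in> measurable M (count_space UNIV)"
    using indep_var_rv1[OF indep] indep_var_rv2[OF indep] by auto
  let ?E = "\<lambda>k. {\<omega> \<in> space M. X \<omega> = k \<and> Y \<omega> = n - k}"
  have "{\<omega> \<in> space M. X \<omega> + Y \<omega> = n} = (\<Union>k\<le>n. ?E k)"
    by auto
  also have "prob \<dots> = (\<Sum>k\<le>n. prob (?E k))"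
    by (intro finite_measure_finite_Union) (auto simp: disjoint_family_on_def)
  also have "\<dots> = (\<Sum>k\<le>n. prob {\<omega> \<in> space M. X \<omega> = k} * prob {\<omega> \<in> space M. Y \<omega> = n - k})"
  proof (rule sum.cong[OF refl])
    fix k
    have "prob ((\<lambda>\<omega>. (X \<omega>, Y \<omega>)) -` ({k} \<times> {n - k}) \<inter> space M) =
        prob (X -` {k} \<inter> space M) * prob (Y -` {n - k} \<inter> space M)"
      by (rule indep_varD[OF indep]) auto
    moreover have "(\<lambda>\<omega>. (X \<omega>, Y \<omega>)) -` ({k} \<times> {n - k}) \<inter> space M = ?E k"
      "X -` {k} \<inter> space M = {\<omega> \<in> space M. X \<omega> = k}"
      "Y -` {n - k} \<inter> space M = {\<omega> \<in> space M. Y \<omega> = n - k}"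
      by auto
    ultimately show "prob (?E k) =
        prob {\<omega> \<in> space M. X \<omega> = k} * prob {\<omega> \<in> space M. Y \<omega> = n - k}"
      by simp
  qed
  finally show ?thesis .
qed

lemma CMP_Z_pos:
  assumes "l > 0" "\<nu> > 0"
  shows "CMP_Z l \<nu> > 0"
  unfolding CMP_Z_def using assms by (intro suminf_pos CMP_Z_summable) auto

theorem corollary3p1:
  fixes M :: "'a measure" and X Y :: "'a \<Rightarrow> nat" and l1 l2 \<nu> :: real
  assumes "prob_space M"
    and "\<nu> > 0" and "\<nu> \<noteq> 1"
    and "l1 > 0" and "l2 > 0"
    and "CMP_distributed M X l1 \<nu>"
    and "CMP_distributed M Y l2 \<nu>"
    and "prob_space.indep_var M (count_space UNIV) X (count_space UNIV) Y"
  shows "\<not> CMP_distributed M (\<lambda>\<omega>. X \<omega> + Y \<omega>) (l1 + l2) \<nu>"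
proof
  assume sum_CMP: "CMP_distributed M (\<lambda>\<omega>. X \<omega> + Y \<omega>) (l1 + l2) \<nu>"
  have "l1 + l2 > 0"
    using assms by simp
  have conv: "CMP_mass (l1 + l2) \<nu> n = (\<Sum>k\<le>n. CMP_mass l1 \<nu> k * CMP_mass l2 \<nu> (n - k))" for n
    using prob_space.prob_add_indep_nat[OF assms(1,8), of n]
    by (simp add: CMP_distributed_prob[OF assms(1,4,2,6)] CMP_distributed_prob[OF assms(1,5,2,7)]
        CMP_distributed_prob[OF assms(1) \<open>l1 + l2 > 0\<close> assms(2) sum_CMP])
  define p where "p = (2 :: real) powr \<nu>"
  define c where "c = 1 / CMP_Z (l1 + l2) \<nu>"
  have "c > 0" "p > 0"
    using CMP_Z_pos[OF \<open>l1 + l2 > 0\<close> \<open>\<nu> > 0\<close>] by (simp_all add: c_def p_def)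
  have c_eq: "c = (1 / CMP_Z l1 \<nu>) * (1 / CMP_Z l2 \<nu>)"
    using conv[of 0] by (simp add: CMP_mass_def c_def)
  have "(l1 + l2)\<^sup>2 / p * c = (l2\<^sup>2 / p + l1 * l2 + l1\<^sup>2 / p) * c"
    using conv[of 2]
    by (simp add: CMP_mass_def c_def[symmetric] c_eq p_def eval_nat_numeral algebra_simps)
  then have "(l1 + l2)\<^sup>2 / p = l2\<^sup>2 / p + l1 * l2 + l1\<^sup>2 / p"
    using \<open>c > 0\<close> by (metis less_irrefl mult_right_cancel)
  then have "l1 * l2 * p = l1 * l2 * 2"
    using \<open>p > 0\<close> by (simp add: field_simps power2_eq_square)
  then have "(2 :: real) powr \<nu> = 2 powr 1"
    using assms by (simp add: p_def)
  then show False
    using \<open>\<nu> \<noteq> 1\<close> powr_inj[of 2 \<nu> 1] by simp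
qed

end
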